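(* Let $Q,Q'\in\mathbb R$ and $\sigma'>0$ be fixed, and for $\sigma>0$ let $\varphi_{Q,\sigma}$ (current) and $\varphi_{Q',\sigma'}$ (target) be Gaussian distributions, with cumulative distribution functions $F_{Q,\sigma}$ and $F_{Q',\sigma'}$. Let $$C(Q,\sigma):=\int_{-\infty}^{\infty}\big(F_{Q,\sigma}(x)-F_{Q',\sigma'}(x)\big)^2\,dx .$$ Then $$\lim_{\sigma\to\infty}\frac{\partial}{\partial Q}C(Q,\sigma)=0 .$$
   Context: $\varphi_{Q,\sigma}(x)=\frac1{\sigma\sqrt{2\pi}}\exp\left(-\frac12\left(\frac{x-Q}{\sigma}\right)^2\right)$ denotes the Gaussian density with mean $Q$ and standard deviation $\sigma$, and $F_{Q,\sigma}(x)=\int_{-\infty}^x\varphi_{Q,\sigma}(t)\,dt$ its cumulative distribution function. $C(Q,\sigma)$ is the energy distance (squared $L_2$ Cramér distance) between the two Gaussian distributions, viewed as a function of $(Q,\sigma)$ with the target $(Q',\sigma')$ fixed. *)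

theory Defs
  imports "HOL-Probability.Probability"
begin

definition gaussian_cdf :: "real \<Rightarrow> real \<Rightarrow> real \<Rightarrow> real" where
  "gaussian_cdf Q \<sigma> x = (LBINT t:{..x}. normal_density Q \<sigma> t)"

(* The target parameters Q', \<sigma>' come first, so that cramer_energy Q' \<sigma>' is the
   function C(Q, \<sigma>). *)
definition cramer_energy :: "real \<Rightarrow> real \<Rightarrow> real \<Rightarrow> real \<Rightarrow> real" where
  "cramer_energy Q' \<sigma>' Q \<sigma> = (LBINT x. (gaussian_cdf Q \<sigma> x - gaussian_cdf Q' \<sigma>' x)\<^sup>2)"

(* The library density is normalised by sqrt (2 * pi * \<sigma>\<^sup>2); for \<sigma> > 0 this is the usual form. *)
lemma normal_density_std_form:
  fixes Q \<sigma> x :: real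
  assumes "\<sigma> > 0"
  shows "normal_density Q \<sigma> x = 1 / (\<sigma> * sqrt (2 * pi)) * exp (- (1/2) * ((x - Q) / \<sigma>)\<^sup>2)"
  using assms by (simp add: normal_density_def real_sqrt_mult power_divide mult.commute)

end

(* Differentiating under the integral sign, the derivative of C in Q is
   2 * LBINT x. (F' x - F x) * \<phi> x, where F and \<phi> are the current distribution function and density
   and F' is the target distribution function.  The substitution x = Q + \<sigma> z turns it into
   2 * LBINT z. (F' (Q + \<sigma> z) - \<Phi> z) * \<phi>\<^sub>0 z with the standard normal \<Phi> and \<phi>\<^sub>0.  As \<sigma> tends to
   infinity, F' (Q + \<sigma> z) tends to the Heaviside function of z, so by dominated convergence the
   limit is the integral of an odd function. *)
theory Submission
  imports Defs
begin

section \<open>Gaussian distribution functions: bounds, limits, scaling and reflection\<close>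

text \<open>This identification gives access to the library facts on \<open>cdf\<close> of a
  probability measure, from which the bounds and the limits at both infinities follow.\<close>

lemma gaussian_cdf_eq_cdf:
  assumes "\<sigma> > 0"
  shows "gaussian_cdf Q \<sigma> = cdf (density lborel (normal_density Q \<sigma>))"
proof
  fix x
  have "cdf (density lborel (normal_density Q \<sigma>)) x
      = enn2real (\<integral>\<^sup>+ t. ennreal (normal_density Q \<sigma> t) * indicator {..x} t \<partial>lborel)"
    by (simp add: cdf_def measure_def emeasure_density)
  also have "\<dots> = enn2real (\<integral>\<^sup>+ t. ennreal (indicator {..x} t *\<^sub>R normal_density Q \<sigma> t) \<partial>lborel)"
    by (intro arg_cong[where f = enn2real] nn_integral_cong) (simp split: split_indicator)
  also have "\<dots> = gaussian_cdf Q \<sigma> x"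
    unfolding gaussian_cdf_def set_lebesgue_integral_def
    by (rule integral_eq_nn_integral[symmetric]) auto
  finally show "gaussian_cdf Q \<sigma> x = cdf (density lborel (normal_density Q \<sigma>)) x" ..
qed

lemma real_distribution_normal_density:
  assumes "\<sigma> > 0"
  shows "real_distribution (density lborel (normal_density Q \<sigma>))"
  using prob_space_normal_density[OF assms, of Q]
  by (simp add: real_distribution_def real_distribution_axioms_def)

lemma gaussian_cdf_nonneg: "\<sigma> > 0 \<Longrightarrow> 0 \<le> gaussian_cdf Q \<sigma> x"
  by (simp add: gaussian_cdf_eq_cdf cdf_def)

lemma gaussian_cdf_le_1: "\<sigma> > 0 \<Longrightarrow> gaussian_cdf Q \<sigma> x \<le> 1"
  by (simp add: gaussian_cdf_eq_cdf real_distribution.cdf_bounded_prob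
      real_distribution_normal_density)

lemma gaussian_cdf_diff_le_1:
  assumes "\<sigma> > 0" "\<tau> > 0"
  shows "\<bar>gaussian_cdf Q \<sigma> x - gaussian_cdf R \<tau> y\<bar> \<le> 1"
  using gaussian_cdf_nonneg[OF assms(1), of Q x] gaussian_cdf_le_1[OF assms(1), of Q x]
    gaussian_cdf_nonneg[OF assms(2), of R y] gaussian_cdf_le_1[OF assms(2), of R y]
  by linarith

lemma gaussian_cdf_at_top: "\<sigma> > 0 \<Longrightarrow> (gaussian_cdf Q \<sigma> \<longlongrightarrow> 1) at_top"
  using real_distribution.cdf_lim_at_top_prob[OF real_distribution_normal_density[of \<sigma> Q]]
  by (simp add: gaussian_cdf_eq_cdf)

lemma gaussian_cdf_at_bot:
  assumes "\<sigma> > 0"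
  shows "(gaussian_cdf Q \<sigma> \<longlongrightarrow> 0) at_bot"
proof -
  interpret real_distribution "density lborel (normal_density Q \<sigma>)"
    by (rule real_distribution_normal_density[OF assms])
  show ?thesis
    using cdf_lim_at_bot assms by (simp add: gaussian_cdf_eq_cdf)
qed

lemma normal_density_affine:
  assumes "\<sigma> > 0"
  shows "\<sigma> * normal_density Q \<sigma> (Q + \<sigma> * z) = std_normal_density z"
  using assms by (simp add: normal_density_def real_sqrt_mult power_mult_distrib)

text \<open>Substitute Q + \<sigma> t for the integration variable: the factor \<sigma> turns the
  density into the standard one, and \<sigma> > 0 keeps the direction of the half-line.\<close>

lemma gaussian_cdf_affine:
  assumes "\<sigma> > 0"
  shows "gaussian_cdf Q \<sigma> (Q + \<sigma> * z) = gaussian_cdf 0 1 z"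
proof -
  have "gaussian_cdf Q \<sigma> (Q + \<sigma> * z)
      = \<sigma> * (LBINT t. indicator {..Q + \<sigma> * z} (Q + \<sigma> * t) *\<^sub>R normal_density Q \<sigma> (Q + \<sigma> * t))"
    using assms lborel_integral_real_affine[of \<sigma>
        "\<lambda>t. indicator {..Q + \<sigma> * z} t *\<^sub>R normal_density Q \<sigma> t" Q]
    by (simp add: gaussian_cdf_def set_lebesgue_integral_def)
  also have "\<dots> = (LBINT t. \<sigma> * (indicator {..Q + \<sigma> * z} (Q + \<sigma> * t) *\<^sub>R normal_density Q \<sigma> (Q + \<sigma> * t)))"
    by simp
  also have "\<dots> = gaussian_cdf 0 1 z"
    unfolding gaussian_cdf_def set_lebesgue_integral_def
  proof (rule Bochner_Integration.integral_cong)
    show "\<sigma> * (indicator {..Q + \<sigma> * z} (Q + \<sigma> * t) *\<^sub>R normal_density Q \<sigma> (Q + \<sigma> * t))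
        = indicator {..z} t *\<^sub>R std_normal_density t" for t
      using assms normal_density_affine[OF assms, of Q t] by (simp add: indicator_def)
  qed simp
  finally show ?thesis .
qed

lemma set_integrable_normal_density:
  "\<sigma> > 0 \<Longrightarrow> A \<in> sets borel \<Longrightarrow> set_integrable lborel A (normal_density Q \<sigma>)"
  unfolding set_integrable_def by (rule integrable_mult_indicator) auto

lemma gaussian_cdf_complement:
  assumes "\<sigma> > 0"
  shows "1 - gaussian_cdf Q \<sigma> x = (LBINT t:{x<..}. normal_density Q \<sigma> t)"
proof -
  have "(LBINT t:{..x} \<union> {x<..}. normal_density Q \<sigma> t)
      = gaussian_cdf Q \<sigma> x + (LBINT t:{x<..}. normal_density Q \<sigma> t)"
    unfolding gaussian_cdf_def
    by (rule set_integral_Un) (auto intro: set_integrable_normal_density assms)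
  moreover have "{..x} \<union> {x<..} = UNIV"
    by auto
  ultimately show ?thesis
    using assms by (simp add: set_lebesgue_integral_def)
qed

text \<open>The reflection t to -t preserves the even density and maps the lower half-line to an
  upper one. The endpoint \<open>z\<close> is a null set, so the complement formula applies.\<close>

lemma gaussian_cdf_std_uminus: "gaussian_cdf 0 1 (- z) = 1 - gaussian_cdf 0 1 z"
proof -
  have "gaussian_cdf 0 1 (- z) = (LBINT t. indicator {..- z} (- t) *\<^sub>R std_normal_density (- t))"
    using lborel_integral_real_affine[of "-1" "\<lambda>t. indicator {..- z} t *\<^sub>R std_normal_density t" 0]
    by (simp add: gaussian_cdf_def set_lebesgue_integral_def)
  also have "\<dots> = (LBINT t:{z<..}. std_normal_density t)"
    unfolding set_lebesgue_integral_def
  proof (rule integral_cong_AE)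
    show "AE t in lborel. indicator {..- z} (- t) *\<^sub>R std_normal_density (- t)
        = indicator {z<..} t *\<^sub>R std_normal_density t"
      using AE_lborel_singleton[of z]
      by eventually_elim (auto simp: std_normal_density_def indicator_def)
  qed measurable
  finally show ?thesis
    by (simp add: gaussian_cdf_complement)
qed

section \<open>Derivatives of the distribution function in the argument and in the mean\<close>

text \<open>The fundamental theorem of calculus is applied on a compact interval around
  \<open>x\<close>; the mass to the left of that interval is a constant.\<close>

lemma DERIV_gaussian_cdf:
  assumes "\<sigma> > 0"
  shows "(gaussian_cdf Q \<sigma> has_real_derivative normal_density Q \<sigma> x) (at x)"
proof -
  let ?a = "x - 1" and ?b = "x + 1"
  have cont: "continuous_on A (normal_density Q \<sigma>)" for A
    unfolding normal_density_def using assms by (auto intro!: continuous_intros)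
  have "((\<lambda>u. integral {?a..u} (normal_density Q \<sigma>)) has_real_derivative normal_density Q \<sigma> x)
      (at x within {?a..?b})"
    by (rule integral_has_real_derivative[OF cont]) simp
  then have D: "((\<lambda>u. gaussian_cdf Q \<sigma> ?a + integral {?a..u} (normal_density Q \<sigma>))
      has_real_derivative normal_density Q \<sigma> x) (at x)"
    by (subst (asm) at_within_interior) (auto intro!: derivative_eq_intros)
  have eq: "gaussian_cdf Q \<sigma> ?a + integral {?a..u} (normal_density Q \<sigma>) = gaussian_cdf Q \<sigma> u"
    if "u \<in> {?a<..<?b}" for u
  proof -
    have "integral {?a..u} (normal_density Q \<sigma>) = (LBINT t:{?a..u}. normal_density Q \<sigma> t)"
      by (rule set_borel_integral_eq_integral(2)[symmetric])
        (simp add: set_integrable_normal_density assms)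
    \<comment> \<open>Dropping the null endpoint makes the interval disjoint from
      \<open>{..?a}\<close>, as additivity over the union requires.\<close>
    also have "\<dots> = (LBINT t:{?a<..u}. normal_density Q \<sigma> t)"
      unfolding set_lebesgue_integral_def
    proof (rule integral_cong_AE)
      show "AE t in lborel. indicator {?a..u} t *\<^sub>R normal_density Q \<sigma> t
          = indicator {?a<..u} t *\<^sub>R normal_density Q \<sigma> t"
        using AE_lborel_singleton[of ?a] by eventually_elim (auto simp: indicator_def)
    qed measurable
    finally have "gaussian_cdf Q \<sigma> ?a + integral {?a..u} (normal_density Q \<sigma>)
        = (LBINT t:{..?a} \<union> {?a<..u}. normal_density Q \<sigma> t)"
      unfolding gaussian_cdf_def
      by (subst set_integral_Un) (auto intro: set_integrable_normal_density assms)
    also have "{..?a} \<union> {?a<..u} = {..u}"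
      using that by auto
    finally show ?thesis
      by (simp add: gaussian_cdf_def)
  qed
  show ?thesis
    by (rule has_field_derivative_transform_within_open[OF D, of "{?a<..<?b}"]) (auto simp: eq)
qed

lemma borel_measurable_gaussian_cdf [measurable]:
  assumes "\<sigma> > 0"
  shows "gaussian_cdf Q \<sigma> \<in> borel_measurable borel"
  by (intro borel_measurable_continuous_onI continuous_at_imp_continuous_on ballI
      DERIV_isCont[OF DERIV_gaussian_cdf[OF assms]])

text \<open>The mean acts as a translation of the argument, so the minus sign is the inner
  derivative of \<open>x - q\<close>.\<close>

lemma DERIV_gaussian_cdf_mean:
  assumes "\<sigma> > 0"
  shows "((\<lambda>q. gaussian_cdf q \<sigma> x) has_real_derivative - normal_density q \<sigma> x) (at q)"
proof -
  have shift: "gaussian_cdf p \<sigma> x = gaussian_cdf 0 \<sigma> (x - p)" for p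
    using gaussian_cdf_affine[OF assms, of p "(x - p) / \<sigma>"]
      gaussian_cdf_affine[OF assms, of 0 "(x - p) / \<sigma>"] assms by simp
  have "normal_density 0 \<sigma> (x - q) = normal_density q \<sigma> x"
    by (simp add: normal_density_def)
  moreover have "((\<lambda>q. x - q) has_real_derivative - 1) (at q)"
    by (auto intro!: derivative_eq_intros)
  ultimately show ?thesis
    unfolding shift
    using DERIV_chain2[where f = "gaussian_cdf 0 \<sigma>" and g = "\<lambda>q. x - q",
        OF DERIV_gaussian_cdf[OF assms]] by fastforce
qed

section \<open>Tail bounds and integrability of the squared difference\<close>

text \<open>A Chebyshev estimate with the weight 1 + t^2, whose Gaussian expectation serves as
  \<open>M\<close>. The resulting bound is integrable over the whole line.\<close>

lemma gaussian_cdf_tail: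
  assumes "\<sigma> > 0"
  obtains M where "\<And>x. x \<le> 0 \<Longrightarrow> gaussian_cdf Q \<sigma> x \<le> M * inverse (1 + x\<^sup>2)"
    and "\<And>x. x \<ge> 0 \<Longrightarrow> 1 - gaussian_cdf Q \<sigma> x \<le> M * inverse (1 + x\<^sup>2)"
proof -
  \<comment> \<open>The weight is expanded by t^2 = (t - Q)^2 + 2 Q t - Q^2, which leaves only the
    total mass, the first moment and the second central moment.\<close>
  have "integrable lborel (\<lambda>t. normal_density Q \<sigma> t + (normal_density Q \<sigma> t * (t - Q)^2
      + (2 * Q * (normal_density Q \<sigma> t * t) - Q\<^sup>2 * normal_density Q \<sigma> t)))"
    by (intro Bochner_Integration.integrable_add Bochner_Integration.integrable_diff
        integrable_mult_right integrable_normal_moment integrable_normal_moment_nz_1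
        integrable_normal_density assms)
  also have "(\<lambda>t. normal_density Q \<sigma> t + (normal_density Q \<sigma> t * (t - Q)^2
      + (2 * Q * (normal_density Q \<sigma> t * t) - Q\<^sup>2 * normal_density Q \<sigma> t)))
      = (\<lambda>t. (1 + t\<^sup>2) * normal_density Q \<sigma> t)"
    by (simp add: fun_eq_iff power2_eq_square algebra_simps)
  finally have int: "integrable lborel (\<lambda>t. (1 + t\<^sup>2) * normal_density Q \<sigma> t)" .
  have bound: "(LBINT t:A. normal_density Q \<sigma> t)
      \<le> (LBINT t. (1 + t\<^sup>2) * normal_density Q \<sigma> t) * inverse (1 + x\<^sup>2)"
    if A: "A \<in> sets borel" "\<And>t. t \<in> A \<Longrightarrow> x\<^sup>2 \<le> t\<^sup>2" for A and x :: real
  proof -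
    have pos: "1 + x\<^sup>2 > 0"
      by (simp add: add_pos_nonneg)
    have "(1 + x\<^sup>2) * (LBINT t:A. normal_density Q \<sigma> t)
        = (LBINT t. (1 + x\<^sup>2) * (indicator A t *\<^sub>R normal_density Q \<sigma> t))"
      by (simp add: set_lebesgue_integral_def)
    also have "\<dots> \<le> (LBINT t. (1 + t\<^sup>2) * normal_density Q \<sigma> t)"
    proof (rule integral_mono[OF _ int])
      show "integrable lborel (\<lambda>t. (1 + x\<^sup>2) * (indicator A t *\<^sub>R normal_density Q \<sigma> t))"
        using set_integrable_normal_density[OF assms A(1)] unfolding set_integrable_def
        by (rule integrable_mult_right)
      show "(1 + x\<^sup>2) * (indicator A t *\<^sub>R normal_density Q \<sigma> t)
          \<le> (1 + t\<^sup>2) * normal_density Q \<sigma> t" for t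
        using A(2)[of t] by (auto simp: indicator_def intro!: mult_right_mono)
    qed
    finally show ?thesis
      using pos by (simp add: field_simps)
  qed
  show ?thesis
  proof
    show "gaussian_cdf Q \<sigma> x \<le> (LBINT t. (1 + t\<^sup>2) * normal_density Q \<sigma> t) * inverse (1 + x\<^sup>2)"
      if "x \<le> 0" for x
      unfolding gaussian_cdf_def using that
      by (intro bound) (auto simp: abs_le_square_iff[symmetric])
    show "1 - gaussian_cdf Q \<sigma> x \<le> (LBINT t. (1 + t\<^sup>2) * normal_density Q \<sigma> t) * inverse (1 + x\<^sup>2)"
      if "x \<ge> 0" for x
      unfolding gaussian_cdf_complement[OF assms] using that
      by (intro bound) (auto simp: abs_le_square_iff[symmetric])
  qed
qed

text \<open>The difference is at most 1 in absolute value, so its square is at most its absolute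
  value. To the left of 0 both functions are small, to the right both complements are, and the tail
  bounds add up.\<close>

lemma integrable_gaussian_cdf_diff_squared:
  assumes "\<sigma> > 0" "\<tau> > 0"
  shows "integrable lborel (\<lambda>x. (gaussian_cdf Q \<sigma> x - gaussian_cdf R \<tau> x)\<^sup>2)"
proof -
  note [measurable] = borel_measurable_gaussian_cdf[OF assms(1)] borel_measurable_gaussian_cdf[OF assms(2)]
  obtain M where M: "\<And>x. x \<le> 0 \<Longrightarrow> gaussian_cdf Q \<sigma> x \<le> M * inverse (1 + x\<^sup>2)"
    "\<And>x. x \<ge> 0 \<Longrightarrow> 1 - gaussian_cdf Q \<sigma> x \<le> M * inverse (1 + x\<^sup>2)"
    using gaussian_cdf_tail[OF assms(1), of Q] by blast
  obtain N where N: "\<And>x. x \<le> 0 \<Longrightarrow> gaussian_cdf R \<tau> x \<le> N * inverse (1 + x\<^sup>2)"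
    "\<And>x. x \<ge> 0 \<Longrightarrow> 1 - gaussian_cdf R \<tau> x \<le> N * inverse (1 + x\<^sup>2)"
    using gaussian_cdf_tail[OF assms(2), of R] by blast
  have "integrable lborel (\<lambda>x::real. inverse (1 + x\<^sup>2))"
    using integrable_inverse_1_plus_square by (simp add: set_integrable_def)
  then have "integrable lborel (\<lambda>x. (M + N) * inverse (1 + x\<^sup>2))"
    by (rule integrable_mult_right)
  then show ?thesis
  proof (rule Bochner_Integration.integrable_bound)
    have "(gaussian_cdf Q \<sigma> x - gaussian_cdf R \<tau> x)\<^sup>2 \<le> (M + N) * inverse (1 + x\<^sup>2)" for x
    proof -
      let ?d = "\<bar>gaussian_cdf Q \<sigma> x - gaussian_cdf R \<tau> x\<bar>"
      have "?d\<^sup>2 \<le> ?d"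
        using mult_left_mono[OF gaussian_cdf_diff_le_1[OF assms, of Q x R x], of ?d]
        by (simp add: power2_eq_square)
      also have "?d \<le> M * inverse (1 + x\<^sup>2) + N * inverse (1 + x\<^sup>2)"
        using M[of x] N[of x] gaussian_cdf_nonneg[OF assms(1), of Q x]
          gaussian_cdf_le_1[OF assms(1), of Q x] gaussian_cdf_nonneg[OF assms(2), of R x]
          gaussian_cdf_le_1[OF assms(2), of R x]
        by (cases "x \<le> 0") linarith+
      finally show ?thesis
        by (simp add: distrib_right)
    qed
    then show "AE x in lborel. norm ((gaussian_cdf Q \<sigma> x - gaussian_cdf R \<tau> x)\<^sup>2)
        \<le> norm ((M + N) * inverse (1 + x\<^sup>2))"
      by (auto intro: order_trans[OF _ abs_ge_self])
  qed measurable
qed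

section \<open>Differentiation under the integral sign\<close>

text \<open>Since \<open>w\<close> bounds the derivative for all parameters near \<open>Q\<close>,
  the mean value inequality bounds the difference quotients by \<open>w\<close> too. Dominated
  convergence along sequences then gives the derivative.\<close>

lemma has_real_derivative_integral_dominated:
  fixes f f' :: "real \<Rightarrow> 'a \<Rightarrow> real" and Q e :: real
  assumes "e > 0"
    and int: "\<And>q. \<bar>q - Q\<bar> < e \<Longrightarrow> integrable M (f q)"
    and meas: "f' Q \<in> borel_measurable M"
    and deriv: "\<And>q x. \<bar>q - Q\<bar> < e \<Longrightarrow> ((\<lambda>q. f q x) has_real_derivative f' q x) (at q)"
    and bound: "\<And>q x. \<bar>q - Q\<bar> < e \<Longrightarrow> \<bar>f' q x\<bar> \<le> w x"
    and w: "integrable M w"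
  shows "((\<lambda>q. \<integral>x. f q x \<partial>M) has_real_derivative (\<integral>x. f' Q x \<partial>M)) (at Q)"
  unfolding has_field_derivative_iff tendsto_at_iff_sequentially
proof (intro allI impI)
  fix X :: "nat \<Rightarrow> real"
  assume X: "\<forall>i. X i \<in> UNIV - {Q}" "X \<longlonglongrightarrow> Q"
  then have "eventually (\<lambda>n. \<bar>X n - Q\<bar> < e) sequentially"
    using tendstoD[OF X(2) \<open>e > 0\<close>] by (simp add: dist_real_def)
  then obtain N where N: "\<And>n. n \<ge> N \<Longrightarrow> \<bar>X n - Q\<bar> < e"
    by (auto simp: eventually_sequentially)
  \<comment> \<open>Cutting off the first \<open>N\<close> terms keeps the whole sequence within
    distance \<open>e\<close> of \<open>Q\<close>, so that the domination holds for every
    index.\<close>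
  define Y where "Y n = X (n + N)" for n
  have Y: "\<bar>Y n - Q\<bar> < e" "Y n \<noteq> Q" for n
    using N X(1) by (auto simp: Y_def)
  have Y_lim: "Y \<longlonglongrightarrow> Q"
    unfolding Y_def by (rule LIMSEQ_ignore_initial_segment[OF X(2)])
  have intQ: "integrable M (f Q)"
    using int \<open>e > 0\<close> by simp
  have "(\<lambda>n. \<integral>x. (f (Y n) x - f Q x) / (Y n - Q) \<partial>M) \<longlonglongrightarrow> (\<integral>x. f' Q x \<partial>M)"
  proof (rule integral_dominated_convergence[OF meas _ w])
    show "(\<lambda>x. (f (Y n) x - f Q x) / (Y n - Q)) \<in> borel_measurable M" for n
      using int[OF Y(1)[of n]] intQ by (intro borel_measurable_integrable) simp
    show "AE x in M. (\<lambda>n. (f (Y n) x - f Q x) / (Y n - Q)) \<longlonglongrightarrow> f' Q x"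
    proof (rule AE_I2)
      fix x
      have "((\<lambda>q. (f q x - f Q x) / (q - Q)) \<longlongrightarrow> f' Q x) (at Q)"
        using deriv[of Q x] \<open>e > 0\<close> by (simp add: has_field_derivative_iff)
      then show "(\<lambda>n. (f (Y n) x - f Q x) / (Y n - Q)) \<longlonglongrightarrow> f' Q x"
        using Y(2) Y_lim unfolding tendsto_at_iff_sequentially comp_def by auto
    qed
    show "AE x in M. norm ((f (Y n) x - f Q x) / (Y n - Q)) \<le> w x" for n
    proof (rule AE_I2)
      fix x
      have "norm (f (Y n) x - f Q x) \<le> w x * norm (Y n - Q)"
      proof (rule field_differentiable_bound[of "ball Q e"])
        fix z
        assume "z \<in> ball Q e"
        then have z: "\<bar>z - Q\<bar> < e"
          by (simp add: dist_real_def abs_minus_commute)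
        show "((\<lambda>q. f q x) has_real_derivative f' z x) (at z within ball Q e)"
          using deriv[OF z] by (rule has_field_derivative_at_within)
        show "norm (f' z x) \<le> w x"
          using bound[OF z] by simp
      qed (use Y(1)[of n] \<open>e > 0\<close> in \<open>auto simp: dist_real_def abs_minus_commute\<close>)
      then show "norm ((f (Y n) x - f Q x) / (Y n - Q)) \<le> w x"
        using Y(2)[of n] by (simp add: field_simps)
    qed
  qed
  also have "(\<lambda>n. \<integral>x. (f (Y n) x - f Q x) / (Y n - Q) \<partial>M)
      = (\<lambda>n. ((\<integral>x. f (Y n) x \<partial>M) - (\<integral>x. f Q x \<partial>M)) / (Y n - Q))"
    using int[OF Y(1)] intQ by simp
  finally show "((\<lambda>q. ((\<integral>x. f q x \<partial>M) - (\<integral>x. f Q x \<partial>M)) / (q - Q)) \<circ> X) \<longlonglongrightarrow> (\<integral>x. f' Q x \<partial>M)"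
    unfolding Y_def comp_def by (rule LIMSEQ_offset)
qed

text \<open>Differentiation in the mean needs one integrable function above all densities with mean
  near \<open>Q\<close>. Doubling the variance halves the exponent, which absorbs the shift of the
  mean up to a constant factor.\<close>

lemma normal_density_le_wider:
  assumes "\<sigma> > 0" "\<bar>q - Q\<bar> < 1"
  shows "normal_density q \<sigma> x \<le> sqrt 2 * exp (1 / (2 * \<sigma>\<^sup>2)) * normal_density Q (sqrt 2 * \<sigma>) x"
proof -
  have scale: "1 / sqrt (2 * pi * \<sigma>\<^sup>2) = sqrt 2 * (1 / sqrt (2 * pi * (sqrt 2 * \<sigma>)\<^sup>2))"
  proof -
    have "2 * pi * (sqrt 2 * \<sigma>)\<^sup>2 = 2 * (2 * pi * \<sigma>\<^sup>2)"
      by (simp add: power_mult_distrib)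
    then have "sqrt (2 * pi * (sqrt 2 * \<sigma>)\<^sup>2) = sqrt 2 * sqrt (2 * pi * \<sigma>\<^sup>2)"
      by (simp only: real_sqrt_mult)
    then show ?thesis
      by simp
  qed
  have "(q - Q)\<^sup>2 \<le> 1"
    using assms(2) by (simp add: abs_square_le_1)
  \<comment> \<open>With a = x - q and b = q - Q this is (a + b)^2 \<le> 2 a^2 + 2 b^2, whose two
    sides differ by (a - b)^2.\<close>
  moreover have "(x - Q)\<^sup>2 \<le> 2 * (x - q)\<^sup>2 + 2 * (q - Q)\<^sup>2"
    using zero_le_power2[of "(x - q) - (q - Q)"] by (simp add: power2_eq_square algebra_simps)
  ultimately have "- (x - q)\<^sup>2 / (2 * \<sigma>\<^sup>2) \<le> 1 / (2 * \<sigma>\<^sup>2) + - (x - Q)\<^sup>2 / (2 * (2 * \<sigma>\<^sup>2))"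
    using assms(1) by (simp add: divide_simps)
  then have "exp (- (x - q)\<^sup>2 / (2 * \<sigma>\<^sup>2)) \<le> exp (1 / (2 * \<sigma>\<^sup>2)) * exp (- (x - Q)\<^sup>2 / (2 * (2 * \<sigma>\<^sup>2)))"
    by (simp flip: exp_add)
  then have "1 / sqrt (2 * pi * \<sigma>\<^sup>2) * exp (- (x - q)\<^sup>2 / (2 * \<sigma>\<^sup>2))
      \<le> 1 / sqrt (2 * pi * \<sigma>\<^sup>2) * (exp (1 / (2 * \<sigma>\<^sup>2)) * exp (- (x - Q)\<^sup>2 / (2 * (2 * \<sigma>\<^sup>2))))"
    by (intro mult_left_mono) auto
  also have "\<dots> = sqrt 2 * exp (1 / (2 * \<sigma>\<^sup>2)) * normal_density Q (sqrt 2 * \<sigma>) x"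
    unfolding normal_density_def scale by (simp add: power_mult_distrib)
  finally show ?thesis
    by (simp add: normal_density_def)
qed

text \<open>The two minus signs, from the chain rule and from reversing the difference, cancel. The
  dominating function is the wider Gaussian, as the difference of distribution functions is at most
  1 in absolute value.\<close>

lemma DERIV_cramer_energy:
  assumes "\<sigma> > 0" "\<sigma>' > 0"
  shows "((\<lambda>q. cramer_energy Q' \<sigma>' q \<sigma>) has_real_derivative
    (LBINT x. 2 * (gaussian_cdf Q' \<sigma>' x - gaussian_cdf Q \<sigma> x) * normal_density Q \<sigma> x)) (at Q)"
  unfolding cramer_energy_def
proof (rule has_real_derivative_integral_dominated[where e = 1 and
      f' = "\<lambda>q x. 2 * (gaussian_cdf Q' \<sigma>' x - gaussian_cdf q \<sigma> x) * normal_density q \<sigma> x" and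
      w = "\<lambda>x. 2 * (sqrt 2 * exp (1 / (2 * \<sigma>\<^sup>2)) * normal_density Q (sqrt 2 * \<sigma>) x)"])
  note [measurable] = borel_measurable_gaussian_cdf[OF assms(1)] borel_measurable_gaussian_cdf[OF assms(2)]
  show "(\<lambda>x. 2 * (gaussian_cdf Q' \<sigma>' x - gaussian_cdf Q \<sigma> x) * normal_density Q \<sigma> x)
      \<in> borel_measurable lborel"
    by measurable
  show "integrable lborel (\<lambda>x. (gaussian_cdf q \<sigma> x - gaussian_cdf Q' \<sigma>' x)\<^sup>2)" for q
    by (rule integrable_gaussian_cdf_diff_squared[OF assms])
  show "((\<lambda>q. (gaussian_cdf q \<sigma> x - gaussian_cdf Q' \<sigma>' x)\<^sup>2) has_real_derivative
      2 * (gaussian_cdf Q' \<sigma>' x - gaussian_cdf q \<sigma> x) * normal_density q \<sigma> x) (at q)" for q x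
    by (auto intro!: derivative_eq_intros DERIV_gaussian_cdf_mean assms simp: algebra_simps)
  show "\<bar>2 * (gaussian_cdf Q' \<sigma>' x - gaussian_cdf q \<sigma> x) * normal_density q \<sigma> x\<bar>
      \<le> 2 * (sqrt 2 * exp (1 / (2 * \<sigma>\<^sup>2)) * normal_density Q (sqrt 2 * \<sigma>) x)"
    if "\<bar>q - Q\<bar> < 1" for q x
    using mult_mono[OF gaussian_cdf_diff_le_1[OF assms(2,1), of Q' x q x]
        normal_density_le_wider[OF assms(1) that, of x]]
    by (simp add: abs_mult mult.assoc del: right_diff_distrib_numeral)
qed (use assms in auto)

text \<open>After the substitution x = Q + \<sigma> z, the scale \<sigma> survives only in the
  argument of the target distribution function, and the integrand has a bound free of
  \<sigma>.\<close>

lemma DERIV_cramer_energy_standardized: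
  assumes "\<sigma> > 0" "\<sigma>' > 0"
  shows "((\<lambda>q. cramer_energy Q' \<sigma>' q \<sigma>) has_real_derivative
    2 * (LBINT z. (gaussian_cdf Q' \<sigma>' (Q + \<sigma> * z) - gaussian_cdf 0 1 z) * std_normal_density z)) (at Q)"
proof -
  have "(LBINT x. 2 * (gaussian_cdf Q' \<sigma>' x - gaussian_cdf Q \<sigma> x) * normal_density Q \<sigma> x)
      = \<sigma> * (LBINT z. 2 * (gaussian_cdf Q' \<sigma>' (Q + \<sigma> * z) - gaussian_cdf Q \<sigma> (Q + \<sigma> * z))
          * normal_density Q \<sigma> (Q + \<sigma> * z))"
    using assms(1) lborel_integral_real_affine[of \<sigma>
        "\<lambda>x. 2 * (gaussian_cdf Q' \<sigma>' x - gaussian_cdf Q \<sigma> x) * normal_density Q \<sigma> x" Q]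
    by simp
  also have "\<dots> = (LBINT z. 2 * ((gaussian_cdf Q' \<sigma>' (Q + \<sigma> * z) - gaussian_cdf Q \<sigma> (Q + \<sigma> * z))
          * (\<sigma> * normal_density Q \<sigma> (Q + \<sigma> * z))))"
    by (subst integral_mult_right_zero[symmetric])
      (simp add: mult_ac del: right_diff_distrib_numeral left_diff_distrib_numeral integral_mult_right_zero)
  also have "\<dots> = 2 * (LBINT z. (gaussian_cdf Q' \<sigma>' (Q + \<sigma> * z) - gaussian_cdf 0 1 z) * std_normal_density z)"
    by (simp only: normal_density_affine[OF assms(1)] gaussian_cdf_affine[OF assms(1)]
        integral_mult_right_zero)
  finally show ?thesis
    using DERIV_cramer_energy[OF assms, of Q' Q] by simp
qed

section \<open>The limit of large \<sigma>\<close>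

text \<open>The limit is the Heaviside function: the argument runs to plus or minus infinity with
  the sign of \<open>z\<close>. At z = 0 the value stays at that in \<open>Q\<close>, which need not
  be 1/2.\<close>

lemma gaussian_cdf_scale_tendsto:
  assumes "\<tau> > 0" "z \<noteq> 0"
  shows "((\<lambda>\<sigma>. gaussian_cdf R \<tau> (Q + \<sigma> * z)) \<longlongrightarrow> (1 + sgn z) / 2) at_top"
proof (cases "z > 0")
  case True
  then have "filterlim (\<lambda>\<sigma>. Q + \<sigma> * z) at_top at_top"
    by (intro filterlim_tendsto_add_at_top[OF tendsto_const]
        filterlim_at_top_mult_tendsto_pos[OF tendsto_const] filterlim_ident)
  from filterlim_compose[OF gaussian_cdf_at_top[OF assms(1)] this] True show ?thesis
    by simp
next
  case False
  with assms(2) have "z < 0"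
    by simp
  then have "filterlim (\<lambda>\<sigma>. - Q + \<sigma> * (- z)) at_top at_top"
    by (intro filterlim_tendsto_add_at_top[OF tendsto_const]
        filterlim_at_top_mult_tendsto_pos[OF tendsto_const] filterlim_ident) simp
  then have "filterlim (\<lambda>\<sigma>. Q + \<sigma> * z) at_bot at_top"
    by (simp add: filterlim_uminus_at_bot)
  from filterlim_compose[OF gaussian_cdf_at_bot[OF assms(1)] this] \<open>z < 0\<close> show ?thesis
    by simp
qed

text \<open>Heaviside minus 1/2 is odd, with \<open>sgn\<close> giving it the value 0 at 0. The
  standard distribution function minus 1/2 is odd by reflection, and the density is even.\<close>

lemma integral_heaviside_minus_std_cdf:
  "(LBINT z. ((1 + sgn z) / 2 - gaussian_cdf 0 1 z) * std_normal_density z) = 0"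
    (is "integral\<^sup>L lborel ?s = 0")
proof -
  have odd: "?s (- z) = - ?s z" for z
    by (simp add: gaussian_cdf_std_uminus sgn_minus std_normal_density_def field_simps)
  have "integral\<^sup>L lborel ?s = (LBINT z. ?s (- z))"
    using lborel_integral_real_affine[of "-1" ?s 0] by simp
  then have "integral\<^sup>L lborel ?s = - integral\<^sup>L lborel ?s"
    unfolding odd by simp
  then show ?thesis
    by simp
qed

text \<open>The first two conjuncts give the limit its meaning: a Bochner integral is 0 by
  convention for a non-integrable function, and \<open>deriv\<close> is unspecified where no
  derivative exists.\<close>

theorem lemma5p2:
  fixes Q Q' \<sigma>' :: real
  assumes "\<sigma>' > 0"
  shows "(\<forall>\<sigma>>0. \<forall>q. integrable lborel (\<lambda>x. (gaussian_cdf q \<sigma> x - gaussian_cdf Q' \<sigma>' x)\<^sup>2)) \<and>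
         (\<forall>\<sigma>>0. (\<lambda>q. cramer_energy Q' \<sigma>' q \<sigma>) differentiable (at Q)) \<and>
         ((\<lambda>\<sigma>. deriv (\<lambda>q. cramer_energy Q' \<sigma>' q \<sigma>) Q) \<longlongrightarrow> 0) at_top"
proof (intro conjI allI impI)
  fix \<sigma> :: real
  assume "\<sigma> > 0"
  then show "integrable lborel (\<lambda>x. (gaussian_cdf q \<sigma> x - gaussian_cdf Q' \<sigma>' x)\<^sup>2)" for q
    using assms by (rule integrable_gaussian_cdf_diff_squared)
  show "(\<lambda>q. cramer_energy Q' \<sigma>' q \<sigma>) differentiable (at Q)"
    using DERIV_cramer_energy[OF \<open>\<sigma> > 0\<close> assms] real_differentiable_def by blast
next
  let ?I = "\<lambda>\<sigma>. LBINT z. (gaussian_cdf Q' \<sigma>' (Q + \<sigma> * z) - gaussian_cdf 0 1 z) * std_normal_density z"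
  note [measurable] = borel_measurable_gaussian_cdf[OF assms] borel_measurable_gaussian_cdf[OF zero_less_one]
  have "(?I \<longlongrightarrow> (LBINT z. ((1 + sgn z) / 2 - gaussian_cdf 0 1 z) * std_normal_density z)) at_top"
  proof (rule integral_dominated_convergence_at_top)
    show "integrable lborel std_normal_density"
      by simp
    show "AE z in lborel. ((\<lambda>\<sigma>. (gaussian_cdf Q' \<sigma>' (Q + \<sigma> * z) - gaussian_cdf 0 1 z) * std_normal_density z)
        \<longlongrightarrow> ((1 + sgn z) / 2 - gaussian_cdf 0 1 z) * std_normal_density z) at_top"
      \<comment> \<open>The point 0, where the Heaviside limit may fail, is a null set.\<close>
      using AE_lborel_singleton[of "0::real"]
      by eventually_elim (intro tendsto_intros gaussian_cdf_scale_tendsto assms)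
    have "norm ((gaussian_cdf Q' \<sigma>' (Q + \<sigma> * z) - gaussian_cdf 0 1 z) * std_normal_density z)
        \<le> std_normal_density z" for \<sigma> z
      using gaussian_cdf_diff_le_1[OF assms zero_less_one, of Q' "Q + \<sigma> * z" 0 z]
      by (simp add: abs_mult mult_left_le_one_le)
    then show "\<forall>\<^sub>F \<sigma> in at_top. AE z in lborel.
        norm ((gaussian_cdf Q' \<sigma>' (Q + \<sigma> * z) - gaussian_cdf 0 1 z) * std_normal_density z)
          \<le> std_normal_density z"
      by simp
  qed measurable
  then have "((\<lambda>\<sigma>. 2 * ?I \<sigma>) \<longlongrightarrow> 0) at_top"
    by (simp add: integral_heaviside_minus_std_cdf tendsto_mult_right_zero)
  \<comment> \<open>The derivative formula is available for \<sigma> > 0, hence eventually along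
    \<open>at_top\<close>.\<close>
  moreover have "\<forall>\<^sub>F \<sigma> in at_top. 2 * ?I \<sigma> = deriv (\<lambda>q. cramer_energy Q' \<sigma>' q \<sigma>) Q"
    using eventually_gt_at_top[of 0]
    by eventually_elim (rule DERIV_imp_deriv[OF DERIV_cramer_energy_standardized[OF _ assms], symmetric])
  ultimately show "((\<lambda>\<sigma>. deriv (\<lambda>q. cramer_energy Q' \<sigma>' q \<sigma>) Q) \<longlongrightarrow> 0) at_top"
    by (rule Lim_transform_eventually)
qed

end
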